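(* Let $f:A\to B$ be a homomorphism of commutative rings with identity, $J$ an ideal of $B$, and $S$ a multiplicative subset of $A$. Set $S'=\{(s,f(s))\mid s\in S\}$ and $f(S)=\{f(s)\in B\mid s\in S\}$. Then the following statements are equivalent: (1) $A\bowtie^f J$ is a $u$-$S'$-Noetherian ring; (2) $A$ is a $u$-$S$-Noetherian ring and $J$ is a $u$-$S'$-Noetherian $A\bowtie^f J$-module (with the $A\bowtie^f J$-module structure naturally induced by $p_B: A\bowtie^f J\to B$, $(a,f(a)+j)\mapsto f(a)+j$); (3) $A$ is a $u$-$S$-Noetherian ring and $f(A)+J$ is a $u$-$f(S)$-Noetherian ring.
   Context: A subset $S$ of a ring is multiplicative if $1\in S$ and $s_1s_2\in S$ for all $s_1,s_2\in S$. The amalgamation of $A$ with $B$ along $J$ with respect to $f$ is the subring $A\bowtie^f J=\{(a,f(a)+j)\mid a\in A,\ j\in J\}$ of $A\times B$. $f(A)+J$ is a subring of $B$. The sets $S'$ and $f(S)$ are multiplicative subsets of $A\bowtie^f J$ and of $B$ (and of $f(A)+J$), respectively. For a commutative ring $R$ with multiplicative subset $S$: an $R$-module $N$ is $u$-$S$-Noetherian if there exists $s\in S$ such that for every submodule $L$ of $N$ there is a finitely generated submodule $F\subseteq L$ with $sL\subseteq F$; the ring $R$ is $u$-$S$-Noetherian if it is so as an $R$-module. *)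

theory Defs
  imports "HOL-Algebra.Module" "HOL-Algebra.Subrings" "HOL-Algebra.Chinese_Remainder"
begin

text \<open>
  A multiplicative subset \<open>S\<close> of a ring \<open>R\<close> is a submonoid of its multiplicative monoid:
  \<^prop>\<open>submonoid S R\<close>.
\<close>

definition gen_submodule :: "('a, 'm) ring_scheme \<Rightarrow> ('a, 'b, 'n) module_scheme \<Rightarrow> 'b set \<Rightarrow> 'b set"
  where "gen_submodule R M E = \<Inter>{H. submodule H R M \<and> E \<subseteq> H}"

definition fin_gen_submodule :: "'b set \<Rightarrow> ('a, 'm) ring_scheme \<Rightarrow> ('a, 'b, 'n) module_scheme \<Rightarrow> bool"
  where "fin_gen_submodule F R M \<longleftrightarrow>
    submodule F R M \<and> (\<exists>E. finite E \<and> E \<subseteq> carrier M \<and> F = gen_submodule R M E)"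

locale u_noetherian_module = module R M + submonoid S R
  for S and R (structure) and M (structure) +
  assumes u_noetherian:
    "\<exists>s\<in>S. \<forall>L. submodule L R M \<longrightarrow>
      (\<exists>F. fin_gen_submodule F R M \<and> F \<subseteq> L \<and> (\<lambda>x. s \<odot>\<^bsub>M\<^esub> x) ` L \<subseteq> F)"

text \<open>
  The additive group on the carrier \<open>N \<subseteq> B\<close> with scalars acting through \<open>\<phi>\<close> followed by
  multiplication in \<open>B\<close>. The fields \<^const>\<open>mult\<close> and \<^const>\<open>one\<close> of a module record carry no
  meaning for modules.
\<close>
definition module_via :: "('r \<Rightarrow> 'b) \<Rightarrow> ('b, 'n) ring_scheme \<Rightarrow> 'b set \<Rightarrow> ('r, 'b) module"
  where "module_via \<phi> B N =
    \<lparr>carrier = N, mult = mult B, one = one B, zero = zero B, add = add B,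
     smult = (\<lambda>r x. \<phi> r \<otimes>\<^bsub>B\<^esub> x)\<rparr>"

definition self_module :: "('a, 'm) ring_scheme \<Rightarrow> ('a, 'a) module"
  where "self_module R = module_via (\<lambda>r. r) R (carrier R)"

definition u_noetherian_ring :: "'a set \<Rightarrow> ('a, 'm) ring_scheme \<Rightarrow> bool"
  where "u_noetherian_ring S R \<longleftrightarrow> u_noetherian_module S R (self_module R)"

definition amalgamation ::
    "('a, 'm) ring_scheme \<Rightarrow> ('b, 'n) ring_scheme \<Rightarrow> ('a \<Rightarrow> 'b) \<Rightarrow> 'b set \<Rightarrow> ('a \<times> 'b) ring"
  where "amalgamation A B f J =
    (RDirProd A B)\<lparr>carrier := {(a, f a \<oplus>\<^bsub>B\<^esub> j) | a j. a \<in> carrier A \<and> j \<in> J}\<rparr>"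

text \<open>The projection \<open>p\<^sub>B\<close> onto the second component is \<^const>\<open>snd\<close>.\<close>
definition amalgamation_ideal_module ::
    "('b, 'n) ring_scheme \<Rightarrow> 'b set \<Rightarrow> ('a \<times> 'b, 'b) module"
  where "amalgamation_ideal_module B J = module_via snd B J"

definition image_plus_ideal ::
    "('a, 'm) ring_scheme \<Rightarrow> ('b, 'n) ring_scheme \<Rightarrow> ('a \<Rightarrow> 'b) \<Rightarrow> 'b set \<Rightarrow> ('b, 'n) ring_scheme"
  where "image_plus_ideal A B f J = B\<lparr>carrier := f ` carrier A <+>\<^bsub>B\<^esub> J\<rparr>"

lemma module_via_is_module:
  assumes R: "cring R" and B: "cring B" and h: "\<phi> \<in> ring_hom R B" and N: "ideal N B"
  shows "module R (module_via \<phi> B N)"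
proof -
  interpret R: cring R by fact
  interpret B: cring B by fact
  interpret N: ideal N B by fact
  interpret h: ring_hom_cring R B \<phi>
    using R B h by (simp add: ring_hom_cring_def ring_hom_cring_axioms_def)
  have mem: "x \<in> carrier B" if "x \<in> N" for x using that N.a_subset by auto
  show ?thesis
  proof (rule moduleI[OF R])
    show "abelian_group (module_via \<phi> B N)"
    proof (rule abelian_groupI)
      fix x assume "x \<in> carrier (module_via \<phi> B N)"
      then show "\<exists>y\<in>carrier (module_via \<phi> B N).
          y \<oplus>\<^bsub>module_via \<phi> B N\<^esub> x = \<zero>\<^bsub>module_via \<phi> B N\<^esub>"
        by (auto simp: module_via_def mem B.l_neg intro!: bexI[of _ "\<ominus>\<^bsub>B\<^esub> x"])
    qed (auto simp: module_via_def mem B.a_ac)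
  qed (auto simp: module_via_def mem N.I_l_closed B.l_distr B.r_distr B.m_assoc)
qed

lemma amalgamation_subcring:
  assumes "ring_hom_cring A B f" and "ideal J B"
  shows "subcring (carrier (amalgamation A B f J)) (RDirProd A B)"
proof -
  interpret f: ring_hom_cring A B f by fact
  interpret J: ideal J B by fact
  interpret P: cring "RDirProd A B"
  proof -
    interpret P: ring "RDirProd A B" by (rule RDirProd_ring) unfold_locales
    show "cring (RDirProd A B)"
      by unfold_locales (auto simp: RDirProd_def DirProd_def monoid.defs f.R.m_comm f.S.m_comm)
  qed
  let ?H = "carrier (amalgamation A B f J)"
  have H: "?H = {(a, f a \<oplus>\<^bsub>B\<^esub> j) | a j. a \<in> carrier A \<and> j \<in> J}"
    by (simp add: amalgamation_def)
  have mem: "x \<in> carrier B" if "x \<in> J" for x using that J.a_subset by auto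
  have ops: "\<And>x y. x \<oplus>\<^bsub>RDirProd A B\<^esub> y = (fst x \<oplus>\<^bsub>A\<^esub> fst y, snd x \<oplus>\<^bsub>B\<^esub> snd y)"
    "\<And>x y. x \<otimes>\<^bsub>RDirProd A B\<^esub> y = (fst x \<otimes>\<^bsub>A\<^esub> fst y, snd x \<otimes>\<^bsub>B\<^esub> snd y)"
    "\<one>\<^bsub>RDirProd A B\<^esub> = (\<one>\<^bsub>A\<^esub>, \<one>\<^bsub>B\<^esub>)" "\<zero>\<^bsub>RDirProd A B\<^esub> = (\<zero>\<^bsub>A\<^esub>, \<zero>\<^bsub>B\<^esub>)"
    by (auto simp: RDirProd_def DirProd_def monoid.defs split: prod.splits)
  have sub: "?H \<subseteq> carrier (RDirProd A B)"
    by (auto simp: H RDirProd_carrier mem)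
  show ?thesis
  proof (rule P.subcringI'[OF P.subringI[OF sub]])
    show "\<one>\<^bsub>RDirProd A B\<^esub> \<in> ?H"
      by (simp add: H ops) (rule exI[of _ "\<zero>\<^bsub>B\<^esub>"], simp)
  next
    fix h assume "h \<in> ?H"
    then obtain a j where h: "h = (a, f a \<oplus>\<^bsub>B\<^esub> j)" "a \<in> carrier A" "j \<in> J"
      by (auto simp: H)
    have "f (\<ominus>\<^bsub>A\<^esub> a) \<oplus>\<^bsub>B\<^esub> \<ominus>\<^bsub>B\<^esub> j = \<ominus>\<^bsub>B\<^esub> (f a \<oplus>\<^bsub>B\<^esub> j)"
      using h mem f.hom_closed[of a] by (simp add: f.S.minus_add)
    then have "(\<ominus>\<^bsub>A\<^esub> a, f (\<ominus>\<^bsub>A\<^esub> a) \<oplus>\<^bsub>B\<^esub> \<ominus>\<^bsub>B\<^esub> j) \<oplus>\<^bsub>RDirProd A B\<^esub> h = \<zero>\<^bsub>RDirProd A B\<^esub>"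
      using h mem f.hom_closed[of a] by (simp add: ops f.R.l_neg f.S.l_neg)
    moreover have m: "(\<ominus>\<^bsub>A\<^esub> a, f (\<ominus>\<^bsub>A\<^esub> a) \<oplus>\<^bsub>B\<^esub> \<ominus>\<^bsub>B\<^esub> j) \<in> ?H"
      unfolding H using h J.a_inv_closed f.R.a_inv_closed by blast
    ultimately show "\<ominus>\<^bsub>RDirProd A B\<^esub> h \<in> ?H"
      using P.minus_equality[OF _ subsetD[OF sub \<open>h \<in> ?H\<close>] subsetD[OF sub m]] by simp
  next
    fix h k assume "h \<in> ?H" "k \<in> ?H"
    then obtain a j b l where hk: "h = (a, f a \<oplus>\<^bsub>B\<^esub> j)" "a \<in> carrier A" "j \<in> J"
      "k = (b, f b \<oplus>\<^bsub>B\<^esub> l)" "b \<in> carrier A" "l \<in> J"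
      by (auto simp: H)
    note c = mem[OF hk(3)] mem[OF hk(6)] f.hom_closed[OF hk(2)] f.hom_closed[OF hk(5)]
    have "(f a \<oplus>\<^bsub>B\<^esub> j) \<otimes>\<^bsub>B\<^esub> (f b \<oplus>\<^bsub>B\<^esub> l) =
        f (a \<otimes>\<^bsub>A\<^esub> b) \<oplus>\<^bsub>B\<^esub> ((f a \<otimes>\<^bsub>B\<^esub> l \<oplus>\<^bsub>B\<^esub> j \<otimes>\<^bsub>B\<^esub> f b) \<oplus>\<^bsub>B\<^esub> j \<otimes>\<^bsub>B\<^esub> l)"
      using c hk by (simp add: f.S.l_distr f.S.r_distr f.S.a_ac)
    moreover have "(f a \<otimes>\<^bsub>B\<^esub> l \<oplus>\<^bsub>B\<^esub> j \<otimes>\<^bsub>B\<^esub> f b) \<oplus>\<^bsub>B\<^esub> j \<otimes>\<^bsub>B\<^esub> l \<in> J"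
      using c hk by (simp add: J.I_l_closed J.I_r_closed)
    ultimately show "h \<otimes>\<^bsub>RDirProd A B\<^esub> k \<in> ?H"
      using hk by (auto simp: H ops)
    have "(f a \<oplus>\<^bsub>B\<^esub> j) \<oplus>\<^bsub>B\<^esub> (f b \<oplus>\<^bsub>B\<^esub> l) = f (a \<oplus>\<^bsub>A\<^esub> b) \<oplus>\<^bsub>B\<^esub> (j \<oplus>\<^bsub>B\<^esub> l)"
      using c hk by (simp add: f.S.a_ac)
    then show "h \<oplus>\<^bsub>RDirProd A B\<^esub> k \<in> ?H"
      using hk by (auto simp: H ops)
  qed
qed

end

theory Submission
  imports Defs
begin

text \<open>
  Write \<open>R\<close> for the amalgamation. The projections of \<open>R\<close> onto \<open>A\<close> and onto \<open>f(A) + J\<close> are surjective,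
  so both rings inherit the property from \<open>R\<close>, and so does \<open>J\<close>, which is isomorphic to the ideal
  \<open>0 \<times> J\<close> of \<open>R\<close>. Conversely \<open>0 \<rightarrow> J \<rightarrow> R \<rightarrow> A \<rightarrow> 0\<close> is exact and the property is closed under
  extensions. Finally, \<open>J\<close> is an ideal of \<open>f(A) + J\<close> and \<open>R\<close> acts on it through its surjection onto
  that ring. All these maps are semilinear along a map of the scalar rings.
\<close>

subsection \<open>Finitely generated submodules\<close>

lemma submodule_zero_closed: "submodule H R M \<Longrightarrow> \<zero>\<^bsub>M\<^esub> \<in> H"
  using subgroup.one_closed[OF submodule.axioms(1)] by fastforce

lemma gen_submodule_incl: "E \<subseteq> gen_submodule R M E"
  by (auto simp: gen_submodule_def)

lemma gen_submodule_least: "submodule H R M \<Longrightarrow> E \<subseteq> H \<Longrightarrow> gen_submodule R M E \<subseteq> H"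
  by (auto simp: gen_submodule_def)

lemma gen_submodule_mono: "E \<subseteq> E' \<Longrightarrow> gen_submodule R M E \<subseteq> gen_submodule R M E'"
  by (auto simp: gen_submodule_def)

text \<open>The carrier itself is one of the submodules being intersected, so the family is
  nonempty. For \<open>E\<close> outside the carrier the intersection would be over the empty
  family, hence everything.\<close>

lemma (in module) gen_submodule_is_submodule:
  assumes "E \<subseteq> carrier M"
  shows "submodule (gen_submodule R M E) R M"
proof (rule submoduleI)
  show "gen_submodule R M E \<subseteq> carrier M"
    using gen_submodule_least[OF carrier_is_submodule assms] .
qed (auto simp: gen_submodule_def submodule_zero_closed submoduleE)

text \<open>A generated submodule lies in \<open>L\<close> exactly when its generators do, so
  \<open>F\<close> can be traded for a finite \<open>E\<close> inside \<open>L\<close> with the same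
  scalar \<open>s\<close>. Only finite sets then have to be moved along maps.\<close>

lemma (in module) u_noetherian_module_iff:
  assumes "submonoid S R"
  shows "u_noetherian_module S R M \<longleftrightarrow>
    (\<exists>s\<in>S. \<forall>L. submodule L R M \<longrightarrow>
      (\<exists>E\<subseteq>L. finite E \<and> (\<forall>x\<in>L. s \<odot>\<^bsub>M\<^esub> x \<in> gen_submodule R M E)))"
proof -
  have "(\<exists>F. fin_gen_submodule F R M \<and> F \<subseteq> L \<and> (\<lambda>x. s \<odot>\<^bsub>M\<^esub> x) ` L \<subseteq> F) \<longleftrightarrow>
      (\<exists>E\<subseteq>L. finite E \<and> (\<forall>x\<in>L. s \<odot>\<^bsub>M\<^esub> x \<in> gen_submodule R M E))"
    if L: "submodule L R M" for s L
  proof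
    assume "\<exists>F. fin_gen_submodule F R M \<and> F \<subseteq> L \<and> (\<lambda>x. s \<odot>\<^bsub>M\<^esub> x) ` L \<subseteq> F"
    then obtain E where "finite E" "gen_submodule R M E \<subseteq> L"
        "(\<lambda>x. s \<odot>\<^bsub>M\<^esub> x) ` L \<subseteq> gen_submodule R M E"
      by (auto simp: fin_gen_submodule_def)
    moreover from this have "E \<subseteq> L"
      using gen_submodule_incl[of E R M] by blast
    ultimately show "\<exists>E\<subseteq>L. finite E \<and> (\<forall>x\<in>L. s \<odot>\<^bsub>M\<^esub> x \<in> gen_submodule R M E)"
      by blast
  next
    assume "\<exists>E\<subseteq>L. finite E \<and> (\<forall>x\<in>L. s \<odot>\<^bsub>M\<^esub> x \<in> gen_submodule R M E)"
    then obtain E where E: "E \<subseteq> L" "finite E" "\<forall>x\<in>L. s \<odot>\<^bsub>M\<^esub> x \<in> gen_submodule R M E"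
      by blast
    have "E \<subseteq> carrier M"
      using E(1) submoduleE(1)[OF L] by blast
    then have "fin_gen_submodule (gen_submodule R M E) R M"
      using E(2) gen_submodule_is_submodule by (auto simp: fin_gen_submodule_def)
    with E gen_submodule_least[OF L E(1)]
    show "\<exists>F. fin_gen_submodule F R M \<and> F \<subseteq> L \<and> (\<lambda>x. s \<odot>\<^bsub>M\<^esub> x) ` L \<subseteq> F"
      by blast
  qed
  then show ?thesis
    using assms module_axioms
    by (simp add: u_noetherian_module_def u_noetherian_module_axioms_def cong: imp_cong)
qed

subsection \<open>Semilinear maps\<close>

text \<open>Two scalar rings are allowed because the projections of the amalgamation change the ring
  together with the module: \<open>\<phi>\<close> moves vectors, \<open>\<pi>\<close> moves
  scalars.\<close>

locale semilinear_map = M: module R M + N: module Q N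
  for R (structure) and M (structure) and Q (structure) and N (structure) and \<pi> \<phi> +
  assumes scalar_closed: "r \<in> carrier R \<Longrightarrow> \<pi> r \<in> carrier Q"
    and map_closed: "x \<in> carrier M \<Longrightarrow> \<phi> x \<in> carrier N"
    and map_add: "x \<in> carrier M \<Longrightarrow> y \<in> carrier M \<Longrightarrow> \<phi> (x \<oplus>\<^bsub>M\<^esub> y) = \<phi> x \<oplus>\<^bsub>N\<^esub> \<phi> y"
    and map_smult: "r \<in> carrier R \<Longrightarrow> x \<in> carrier M \<Longrightarrow> \<phi> (r \<odot>\<^bsub>M\<^esub> x) = \<pi> r \<odot>\<^bsub>N\<^esub> \<phi> x"
begin

lemma map_zero: "\<phi> \<zero>\<^bsub>M\<^esub> = \<zero>\<^bsub>N\<^esub>"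
proof -
  have "\<phi> \<zero>\<^bsub>M\<^esub> \<oplus>\<^bsub>N\<^esub> \<phi> \<zero>\<^bsub>M\<^esub> = \<phi> \<zero>\<^bsub>M\<^esub>"
    using map_add[of "\<zero>\<^bsub>M\<^esub>" "\<zero>\<^bsub>M\<^esub>"] by simp
  then show ?thesis
    using map_closed[of "\<zero>\<^bsub>M\<^esub>"] by (simp add: N.M.add.r_cancel_one')
qed

lemma map_neg:
  assumes "x \<in> carrier M"
  shows "\<phi> (\<ominus>\<^bsub>M\<^esub> x) = \<ominus>\<^bsub>N\<^esub> \<phi> x"
proof -
  have "\<phi> (\<ominus>\<^bsub>M\<^esub> x) \<oplus>\<^bsub>N\<^esub> \<phi> x = \<zero>\<^bsub>N\<^esub>"
    using map_add[of "\<ominus>\<^bsub>M\<^esub> x" x] assms by (simp add: M.M.l_neg map_zero)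
  then show ?thesis
    using assms map_closed N.M.minus_equality by fastforce
qed

lemma vimage_submodule:
  assumes "submodule L Q N"
  shows "submodule {x \<in> carrier M. \<phi> x \<in> L} R M"
  by (rule M.submoduleI)
    (auto simp: map_zero map_neg map_add map_smult scalar_closed submodule_zero_closed[OF assms]
      N.submoduleE[OF assms])

text \<open>Closure under a scalar of \<open>Q\<close> comes from lifting it along
  \<open>\<pi>\<close> to \<open>R\<close>, where \<open>L\<close> is closed; hence the surjectivity
  assumption.\<close>

lemma image_submodule:
  assumes L: "submodule L R M" and surj: "carrier Q \<subseteq> \<pi> ` carrier R"
  shows "submodule (\<phi> ` L) Q N"
proof (rule N.submoduleI)
  note sub = subsetD[OF M.submoduleE(1)[OF L]]
  show "\<phi> ` L \<subseteq> carrier N"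
    using sub map_closed by auto
  show "\<zero>\<^bsub>N\<^esub> \<in> \<phi> ` L"
    using submodule_zero_closed[OF L] by (intro image_eqI[of _ _ "\<zero>\<^bsub>M\<^esub>"]) (simp_all add: map_zero)
  show "\<ominus>\<^bsub>N\<^esub> a \<in> \<phi> ` L" if a: "a \<in> \<phi> ` L" for a
  proof -
    obtain x where "a = \<phi> x" "x \<in> L"
      using a by blast
    then show ?thesis
      using map_neg[OF sub] M.submoduleE(3)[OF L] by (intro image_eqI[of _ _ "\<ominus>\<^bsub>M\<^esub> x"]) auto
  qed
  show "a \<oplus>\<^bsub>N\<^esub> b \<in> \<phi> ` L" if ab: "a \<in> \<phi> ` L" "b \<in> \<phi> ` L" for a b
  proof -
    obtain x y where "a = \<phi> x" "b = \<phi> y" "x \<in> L" "y \<in> L"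
      using ab by blast
    then show ?thesis
      using map_add[OF sub sub] M.submoduleE(5)[OF L]
      by (intro image_eqI[of _ _ "x \<oplus>\<^bsub>M\<^esub> y"]) auto
  qed
  show "q \<odot>\<^bsub>N\<^esub> a \<in> \<phi> ` L" if qa: "q \<in> carrier Q" "a \<in> \<phi> ` L" for q a
  proof -
    obtain r x where "q = \<pi> r" "r \<in> carrier R" "a = \<phi> x" "x \<in> L"
      using qa surj by blast
    then show ?thesis
      using map_smult[OF _ sub] M.submoduleE(4)[OF L]
      by (intro image_eqI[of _ _ "r \<odot>\<^bsub>M\<^esub> x"]) auto
  qed
qed

lemma image_gen_submodule:
  assumes "E \<subseteq> carrier M" and "x \<in> gen_submodule R M E"
  shows "\<phi> x \<in> gen_submodule Q N (\<phi> ` E)"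
proof -
  have "\<phi> ` E \<subseteq> carrier N"
    using assms(1) map_closed by blast
  then have "submodule {x \<in> carrier M. \<phi> x \<in> gen_submodule Q N (\<phi> ` E)} R M"
    by (intro vimage_submodule N.gen_submodule_is_submodule)
  then have "gen_submodule R M E \<subseteq> {x \<in> carrier M. \<phi> x \<in> gen_submodule Q N (\<phi> ` E)}"
    by (rule gen_submodule_least) (use assms(1) gen_submodule_incl[of "\<phi> ` E" Q N] in auto)
  with assms(2) show ?thesis
    by blast
qed

text \<open>The converse inclusion, by which elements spanned in \<open>N\<close> are lifted to
  elements spanned in \<open>M\<close>.\<close>

lemma gen_submodule_image_le:
  assumes "E \<subseteq> carrier M" and "carrier Q \<subseteq> \<pi> ` carrier R"
  shows "gen_submodule Q N (\<phi> ` E) \<subseteq> \<phi> ` gen_submodule R M E"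
  using assms gen_submodule_incl[of E R M]
  by (intro gen_submodule_least image_submodule M.gen_submodule_is_submodule) auto

section \<open>Uniform Noetherianity along semilinear maps\<close>

text \<open>Generators of the preimage of \<open>L\<close> are pushed forward to \<open>L\<close>.
  The new scalar \<open>\<pi> s\<close> depends only on \<open>s\<close>, so it stays uniform in
  \<open>L\<close>.\<close>

lemma u_noetherian_image:
  assumes M: "u_noetherian_module S R M" and surj: "carrier N \<subseteq> \<phi> ` carrier M"
    and T: "submonoid T Q" "\<pi> ` S \<subseteq> T"
  shows "u_noetherian_module T Q N"
proof -
  have S: "submonoid S R"
    using M u_noetherian_module.axioms(2) by blast
  obtain s where s: "s \<in> S" and fg: "\<And>L. submodule L R M \<Longrightarrow>
      \<exists>E\<subseteq>L. finite E \<and> (\<forall>x\<in>L. s \<odot>\<^bsub>M\<^esub> x \<in> gen_submodule R M E)"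
    using M unfolding M.u_noetherian_module_iff[OF S] by blast
  have "\<exists>E\<subseteq>L. finite E \<and> (\<forall>y\<in>L. \<pi> s \<odot>\<^bsub>N\<^esub> y \<in> gen_submodule Q N E)"
    if L: "submodule L Q N" for L
  proof -
    obtain E where E: "E \<subseteq> {x \<in> carrier M. \<phi> x \<in> L}" "finite E"
      "\<forall>x\<in>{x \<in> carrier M. \<phi> x \<in> L}. s \<odot>\<^bsub>M\<^esub> x \<in> gen_submodule R M E"
      using fg[OF vimage_submodule[OF L]] by blast
    have "\<pi> s \<odot>\<^bsub>N\<^esub> y \<in> gen_submodule Q N (\<phi> ` E)" if "y \<in> L" for y
    proof -
      obtain x where x: "x \<in> carrier M" "y = \<phi> x"
        using \<open>y \<in> L\<close> N.submoduleE(1)[OF L] surj by blast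
      then have "\<phi> (s \<odot>\<^bsub>M\<^esub> x) \<in> gen_submodule Q N (\<phi> ` E)"
        using E \<open>y \<in> L\<close> by (intro image_gen_submodule) auto
      then show ?thesis
        using x s S by (simp add: map_smult submonoid.mem_carrier)
    qed
    with E show ?thesis
      by (intro exI[of _ "\<phi> ` E"]) auto
  qed
  with s T show ?thesis
    unfolding N.u_noetherian_module_iff[OF T(1)] by blast
qed

text \<open>The common core of the injective case and of the extension case. If \<open>s\<close>
  lifts the uniform scalar of \<open>N\<close> and \<open>t\<close> handles the elements of
  \<open>L\<close> killed by \<open>\<phi>\<close>, then the product of \<open>t\<close> and
  \<open>s\<close> works for every \<open>L\<close>.\<close>

lemma u_noetherian_by_kernel:
  assumes S: "submonoid S R" and surj: "carrier Q \<subseteq> \<pi> ` carrier R"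
    and N: "u_noetherian_module T Q N" and T: "T \<subseteq> \<pi> ` S"
    and t: "t \<in> S" and ker: "\<And>L. submodule L R M \<Longrightarrow>
      \<exists>E\<subseteq>L. finite E \<and> (\<forall>x\<in>L. \<phi> x = \<zero>\<^bsub>N\<^esub> \<longrightarrow> t \<odot>\<^bsub>M\<^esub> x \<in> gen_submodule R M E)"
  shows "u_noetherian_module S R M"
proof -
  have sub_T: "submonoid T Q"
    using N u_noetherian_module.axioms(2) by blast
  obtain u where u: "u \<in> T" "\<And>L. submodule L Q N \<Longrightarrow>
      \<exists>E\<subseteq>L. finite E \<and> (\<forall>y\<in>L. u \<odot>\<^bsub>N\<^esub> y \<in> gen_submodule Q N E)"
    using N unfolding N.u_noetherian_module_iff[OF sub_T] by blast
  \<comment> \<open>The uniform scalar for \<open>M\<close> has to come from \<open>S\<close>, so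
    the one for \<open>N\<close> is lifted along \<open>\<pi>\<close>.\<close>
  then obtain s where s: "s \<in> S" "u = \<pi> s"
    using T by blast
  note fg = u(2)[unfolded s(2)]
  have carr: "s \<in> carrier R" "t \<in> carrier R" and st: "t \<otimes>\<^bsub>R\<^esub> s \<in> S"
    using s(1) t S by (simp_all add: submonoid.mem_carrier submonoid.m_closed)
  have "\<exists>E\<subseteq>L. finite E \<and> (\<forall>x\<in>L. (t \<otimes>\<^bsub>R\<^esub> s) \<odot>\<^bsub>M\<^esub> x \<in> gen_submodule R M E)"
    if L: "submodule L R M" for L
  proof -
    note sub = subsetD[OF M.submoduleE(1)[OF L]]
    obtain E0 where E0: "E0 \<subseteq> \<phi> ` L" "finite E0"
      "\<forall>y\<in>\<phi> ` L. \<pi> s \<odot>\<^bsub>N\<^esub> y \<in> gen_submodule Q N E0"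
      using fg[OF image_submodule[OF L surj]] by blast
    \<comment> \<open>The finitely many generators of the image are lifted into \<open>L\<close>
      itself.\<close>
    obtain E1 where E1: "E1 \<subseteq> L" "finite E1" "E0 = \<phi> ` E1"
      using finite_subset_image[OF E0(2,1)] by blast
    obtain E2 where E2: "E2 \<subseteq> L" "finite E2"
      "\<forall>x\<in>L. \<phi> x = \<zero>\<^bsub>N\<^esub> \<longrightarrow> t \<odot>\<^bsub>M\<^esub> x \<in> gen_submodule R M E2"
      using ker[OF L] by blast
    have carrE: "E1 \<subseteq> carrier M" "E1 \<union> E2 \<subseteq> carrier M"
      using E1(1) E2(1) sub by auto
    note G = M.submoduleE[OF M.gen_submodule_is_submodule[OF carrE(2)]]
    have "(t \<otimes>\<^bsub>R\<^esub> s) \<odot>\<^bsub>M\<^esub> x \<in> gen_submodule R M (E1 \<union> E2)" if x: "x \<in> L" for x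
    proof -
      have "\<pi> s \<odot>\<^bsub>N\<^esub> \<phi> x \<in> \<phi> ` gen_submodule R M E1"
        using E0(3) x gen_submodule_image_le[OF carrE(1) surj] E1(3) by blast
      \<comment> \<open>The span of \<open>E1\<close> contains an element with the same image as
        \<open>s x\<close>, so \<open>s x - y\<close> lies in the kernel.\<close>
      then obtain y where y: "y \<in> gen_submodule R M E1" "\<phi> y = \<phi> (s \<odot>\<^bsub>M\<^esub> x)"
        using map_smult[OF carr(1) sub[OF x]] by auto
      \<comment> \<open>Needed for \<open>s x - y\<close> to lie in \<open>L\<close>, where the
        choice of \<open>E2\<close> applies to it.\<close>
      have yL: "y \<in> L"
        using y(1) gen_submodule_least[OF L E1(1)] by blast
      note xy = sub[OF x] sub[OF yL]
      have "s \<odot>\<^bsub>M\<^esub> x \<oplus>\<^bsub>M\<^esub> \<ominus>\<^bsub>M\<^esub> y \<in> L"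
        using M.submoduleE[OF L] carr x yL by blast
      moreover have "\<phi> (s \<odot>\<^bsub>M\<^esub> x \<oplus>\<^bsub>M\<^esub> \<ominus>\<^bsub>M\<^esub> y) = \<zero>\<^bsub>N\<^esub>"
        using xy carr y(2) map_closed[of y] by (simp add: map_add map_neg N.M.r_neg)
      ultimately have "t \<odot>\<^bsub>M\<^esub> (s \<odot>\<^bsub>M\<^esub> x \<oplus>\<^bsub>M\<^esub> \<ominus>\<^bsub>M\<^esub> y) \<in> gen_submodule R M (E1 \<union> E2)"
        using E2(3) gen_submodule_mono[of E2 "E1 \<union> E2"] by blast
      moreover have "t \<odot>\<^bsub>M\<^esub> y \<in> gen_submodule R M (E1 \<union> E2)"
        using y(1) gen_submodule_mono[of E1 "E1 \<union> E2"] carr(2) by (intro G(4)) auto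
      \<comment> \<open>The decomposition \<open>(t s) x = t (s x - y) + t y\<close>: the first term
        is spanned by \<open>E2\<close>, the second by \<open>E1\<close>.\<close>
      moreover have "(t \<otimes>\<^bsub>R\<^esub> s) \<odot>\<^bsub>M\<^esub> x =
          t \<odot>\<^bsub>M\<^esub> (s \<odot>\<^bsub>M\<^esub> x \<oplus>\<^bsub>M\<^esub> \<ominus>\<^bsub>M\<^esub> y) \<oplus>\<^bsub>M\<^esub> t \<odot>\<^bsub>M\<^esub> y"
        using xy carr
        by (simp add: M.smult_assoc1 M.smult_r_distr M.smult_r_minus M.M.a_assoc M.M.l_neg)
      ultimately show ?thesis
        using G(5) by metis
    qed
    with E1 E2 show ?thesis
      by (intro exI[of _ "E1 \<union> E2"]) auto
  qed
  with st show ?thesis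
    unfolding M.u_noetherian_module_iff[OF S] by blast
qed

text \<open>The kernel is zero, so the empty set of generators and the scalar one settle the kernel
  condition.\<close>

lemma u_noetherian_inj:
  assumes S: "submonoid S R" and surj: "carrier Q \<subseteq> \<pi> ` carrier R"
    and N: "u_noetherian_module T Q N" and T: "T \<subseteq> \<pi> ` S"
    and inj: "inj_on \<phi> (carrier M)"
  shows "u_noetherian_module S R M"
proof (rule u_noetherian_by_kernel[OF S surj N T submonoid.one_closed[OF S]])
  fix L assume L: "submodule L R M"
  have "\<one>\<^bsub>R\<^esub> \<odot>\<^bsub>M\<^esub> x \<in> gen_submodule R M {}" if "x \<in> L" "\<phi> x = \<zero>\<^bsub>N\<^esub>" for x
  proof -
    have "x = \<zero>\<^bsub>M\<^esub>"
      using that M.submoduleE(1)[OF L] inj map_zero by (metis M.M.zero_closed inj_onD subsetD)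
    then show ?thesis
      using submodule_zero_closed[OF M.gen_submodule_is_submodule] by simp
  qed
  then show "\<exists>E\<subseteq>L. finite E \<and>
      (\<forall>x\<in>L. \<phi> x = \<zero>\<^bsub>N\<^esub> \<longrightarrow> \<one>\<^bsub>R\<^esub> \<odot>\<^bsub>M\<^esub> x \<in> gen_submodule R M E)"
    by (intro exI[of _ "{}"]) auto
qed

text \<open>Elements of \<open>L\<close> killed by \<open>\<phi>\<close> come from \<open>K\<close>.
  Generators of the preimage of \<open>L\<close> in \<open>K\<close> are pushed into
  \<open>L\<close> by \<open>\<iota>\<close>, and the uniform scalar \<open>t\<close> of
  \<open>K\<close> settles the kernel condition.\<close>

lemma u_noetherian_extension:
  assumes S: "submonoid S R" and surj: "carrier Q \<subseteq> \<pi> ` carrier R"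
    and N: "u_noetherian_module T Q N" and T: "T \<subseteq> \<pi> ` S"
    and K: "u_noetherian_module S R K" and \<iota>: "semilinear_map R K R M (\<lambda>r. r) \<iota>"
    and ker: "\<And>x. x \<in> carrier M \<Longrightarrow> \<phi> x = \<zero>\<^bsub>N\<^esub> \<Longrightarrow> x \<in> \<iota> ` carrier K"
  shows "u_noetherian_module S R M"
proof -
  interpret \<iota>: semilinear_map R K R M "\<lambda>r. r" \<iota>
    by (fact \<iota>)
  obtain t where t: "t \<in> S" and fg: "\<And>L. submodule L R K \<Longrightarrow>
      \<exists>E\<subseteq>L. finite E \<and> (\<forall>x\<in>L. t \<odot>\<^bsub>K\<^esub> x \<in> gen_submodule R K E)"
    using K unfolding \<iota>.M.u_noetherian_module_iff[OF S] by blast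
  show ?thesis
  proof (rule u_noetherian_by_kernel[OF S surj N T t])
    fix L assume L: "submodule L R M"
    obtain E where E: "E \<subseteq> {k \<in> carrier K. \<iota> k \<in> L}" "finite E"
      "\<forall>k\<in>{k \<in> carrier K. \<iota> k \<in> L}. t \<odot>\<^bsub>K\<^esub> k \<in> gen_submodule R K E"
      using fg[OF \<iota>.vimage_submodule[OF L]] by blast
    have "t \<odot>\<^bsub>M\<^esub> x \<in> gen_submodule R M (\<iota> ` E)" if x: "x \<in> L" "\<phi> x = \<zero>\<^bsub>N\<^esub>" for x
    proof -
      obtain k where k: "k \<in> carrier K" "x = \<iota> k"
        using x ker M.submoduleE(1)[OF L] by blast
      then have "\<iota> (t \<odot>\<^bsub>K\<^esub> k) \<in> gen_submodule R M (\<iota> ` E)"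
        using E x by (intro \<iota>.image_gen_submodule) auto
      then show ?thesis
        using k t S by (simp add: \<iota>.map_smult submonoid.mem_carrier)
    qed
    with E show "\<exists>E\<subseteq>L. finite E \<and>
        (\<forall>x\<in>L. \<phi> x = \<zero>\<^bsub>N\<^esub> \<longrightarrow> t \<odot>\<^bsub>M\<^esub> x \<in> gen_submodule R M E)"
      by (intro exI[of _ "\<iota> ` E"]) auto
  qed
qed

end

subsection \<open>The amalgamation\<close>

lemma module_via_simps:
  "carrier (module_via \<phi> B N) = N"
  "\<zero>\<^bsub>module_via \<phi> B N\<^esub> = \<zero>\<^bsub>B\<^esub>"
  "x \<oplus>\<^bsub>module_via \<phi> B N\<^esub> y = x \<oplus>\<^bsub>B\<^esub> y"
  "r \<odot>\<^bsub>module_via \<phi> B N\<^esub> x = \<phi> r \<otimes>\<^bsub>B\<^esub> x"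
  by (simp_all add: module_via_def)

lemma self_module_is_module:
  assumes "cring R"
  shows "module R (self_module R)"
proof -
  interpret cring R by fact
  show ?thesis
    unfolding self_module_def
    by (rule module_via_is_module[OF assms assms _ oneideal]) (auto simp: ring_hom_def)
qed

lemma amalgamation_simps:
  "carrier (amalgamation A B f J) = {(a, f a \<oplus>\<^bsub>B\<^esub> j) | a j. a \<in> carrier A \<and> j \<in> J}"
  "\<zero>\<^bsub>amalgamation A B f J\<^esub> = (\<zero>\<^bsub>A\<^esub>, \<zero>\<^bsub>B\<^esub>)"
  "\<one>\<^bsub>amalgamation A B f J\<^esub> = (\<one>\<^bsub>A\<^esub>, \<one>\<^bsub>B\<^esub>)"
  "x \<oplus>\<^bsub>amalgamation A B f J\<^esub> y = (fst x \<oplus>\<^bsub>A\<^esub> fst y, snd x \<oplus>\<^bsub>B\<^esub> snd y)"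
  "x \<otimes>\<^bsub>amalgamation A B f J\<^esub> y = (fst x \<otimes>\<^bsub>A\<^esub> fst y, snd x \<otimes>\<^bsub>B\<^esub> snd y)"
  by (auto simp: amalgamation_def RDirProd_def DirProd_def monoid.defs split: prod.splits)

text \<open>Writing the carrier as the image of \<open>snd\<close> makes the surjectivity of the
  second projection immediate.\<close>

lemma image_plus_ideal_simps:
  "carrier (image_plus_ideal A B f J) = snd ` carrier (amalgamation A B f J)"
  "\<zero>\<^bsub>image_plus_ideal A B f J\<^esub> = \<zero>\<^bsub>B\<^esub>"
  "\<one>\<^bsub>image_plus_ideal A B f J\<^esub> = \<one>\<^bsub>B\<^esub>"
  "x \<oplus>\<^bsub>image_plus_ideal A B f J\<^esub> y = x \<oplus>\<^bsub>B\<^esub> y"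
  "x \<otimes>\<^bsub>image_plus_ideal A B f J\<^esub> y = x \<otimes>\<^bsub>B\<^esub> y"
  by (force simp: image_plus_ideal_def set_add_def' amalgamation_simps)+

locale amalgamation_setting = f: ring_hom_cring A B f + J: ideal J B
  for A :: "('a, 'm) ring_scheme" and B :: "('b, 'n) ring_scheme" and f J
begin

abbreviation "P \<equiv> amalgamation A B f J"
abbreviation "C \<equiv> image_plus_ideal A B f J"

lemma J_carrier: "j \<in> J \<Longrightarrow> j \<in> carrier B"
  using J.a_subset by auto

lemma amalgamation_cring: "cring P"
proof -
  interpret RP: ring "RDirProd A B"
    by (rule RDirProd_ring) unfold_locales
  have "subcring (carrier P) (RDirProd A B)"
    by (intro amalgamation_subcring f.ring_hom_cring_axioms J.ideal_axioms)
  moreover from this have "carrier P \<subseteq> carrier (RDirProd A B)"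
    using subcring.axioms(1) subring.axioms(1) subgroup.subset by fastforce
  ultimately show ?thesis
    using RP.subcring_iff by (simp add: amalgamation_def)
qed

lemma fst_closed: "r \<in> carrier P \<Longrightarrow> fst r \<in> carrier A"
  and snd_closed: "r \<in> carrier P \<Longrightarrow> snd r \<in> carrier B"
  by (auto simp: amalgamation_simps J_carrier)

lemma snd_ring_hom: "snd \<in> ring_hom P B"
  by (rule ring_hom_memI) (auto simp: snd_closed amalgamation_simps)

text \<open>The choice \<open>j = 0\<close>. The graph of \<open>f\<close> supplies preimages under
  \<open>fst\<close> and contains the multiplicative set of pairs \<open>(s, f s)\<close>.\<close>

lemma graph_closed: "a \<in> carrier A \<Longrightarrow> (a, f a) \<in> carrier P"
  by (auto simp: amalgamation_simps intro!: exI[of _ "\<zero>\<^bsub>B\<^esub>"])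

lemma fst_surj: "carrier A \<subseteq> fst ` carrier P"
  using graph_closed by (metis fst_conv imageI subsetI)

text \<open>Since \<open>f\<close> sends zero to zero, this identifies the kernel of
  \<open>fst\<close> on \<open>P\<close> with a copy of \<open>J\<close>; the exactness of the
  sequence rests on it.\<close>

lemma zero_prod_iff: "(\<zero>\<^bsub>A\<^esub>, b) \<in> carrier P \<longleftrightarrow> b \<in> J"
  by (auto simp: amalgamation_simps J_carrier intro!: exI[of _ b])

lemma ideal_le_image_plus_ideal: "J \<subseteq> carrier C"
  unfolding image_plus_ideal_simps
  by (metis zero_prod_iff snd_conv imageI subsetI)

text \<open>As the image of the ring homomorphism \<open>snd\<close>, the set is a subring of
  \<open>B\<close>, and no closure property has to be computed by hand.\<close>

lemma image_plus_ideal_cring: "cring C"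
proof -
  interpret P: cring P
    by (rule amalgamation_cring)
  interpret p: ring_hom_ring P B snd
    by (intro ring_hom_ringI2 P.ring_axioms f.S.ring_axioms snd_ring_hom)
  have "subcring (snd ` carrier P) B"
    by (intro f.S.subcringI' p.img_is_subring P.carrier_is_subring)
  moreover have "C = B\<lparr>carrier := snd ` carrier P\<rparr>"
    using image_plus_ideal_simps(1)[of A B f J] by (simp add: image_plus_ideal_def)
  ultimately show ?thesis
    using f.S.subcring_iff[of "snd ` carrier P"] snd_closed by (simp add: image_subset_iff)
qed

lemma ideal_module: "module P (amalgamation_ideal_module B J)"
  unfolding amalgamation_ideal_module_def
  by (intro module_via_is_module amalgamation_cring f.S.cring_axioms snd_ring_hom J.ideal_axioms)

lemmas module_facts =
  ideal_module self_module_is_module[OF amalgamation_cring]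
  self_module_is_module[OF image_plus_ideal_cring] self_module_is_module[OF f.R.cring_axioms]

lemmas carrier_simps =
  module_via_simps self_module_def amalgamation_ideal_module_def

section \<open>The four semilinear maps\<close>

lemma fst_semilinear: "semilinear_map P (self_module P) A (self_module A) fst fst"
  by (intro semilinear_map.intro semilinear_map_axioms.intro module_facts)
    (simp_all add: carrier_simps fst_closed amalgamation_simps(4,5))

lemma snd_semilinear: "semilinear_map P (self_module P) C (self_module C) snd snd"
  by (intro semilinear_map.intro semilinear_map_axioms.intro module_facts)
    (simp_all add: carrier_simps image_plus_ideal_simps amalgamation_simps(4,5))

text \<open>Plays two parts: the left map of the exact sequence, and the embedding by which
  \<open>J\<close> inherits the property from \<open>P\<close>.\<close>

lemma ideal_into_amalgamation_semilinear:
  "semilinear_map P (amalgamation_ideal_module B J) P (self_module P) (\<lambda>r. r) (\<lambda>j. (\<zero>\<^bsub>A\<^esub>, j))"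
  by (intro semilinear_map.intro semilinear_map_axioms.intro module_facts)
    (simp_all add: carrier_simps zero_prod_iff fst_closed amalgamation_simps(4,5))

text \<open>\<open>P\<close> acts on \<open>J\<close> only through \<open>snd\<close>, so the
  inclusion of \<open>J\<close> into \<open>C\<close> is semilinear along
  \<open>snd\<close>.\<close>

lemma ideal_into_image_plus_ideal_semilinear:
  "semilinear_map P (amalgamation_ideal_module B J) C (self_module C) snd (\<lambda>j. j)"
  by (intro semilinear_map.intro semilinear_map_axioms.intro module_facts)
    (use ideal_le_image_plus_ideal in
      \<open>auto simp: carrier_simps image_plus_ideal_simps(1,4,5)\<close>)

section \<open>Multiplicative subsets of the two rings\<close>

lemma submonoid_amalgamation:
  assumes "submonoid S A"
  shows "submonoid {(s, f s) | s. s \<in> S} P"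
proof -
  interpret S: submonoid S A by fact
  show ?thesis
  proof
    show "{(s, f s) | s. s \<in> S} \<subseteq> carrier P"
      using graph_closed by auto
  qed (auto simp: amalgamation_simps)
qed

lemma submonoid_image_plus_ideal:
  assumes "submonoid S A"
  shows "submonoid (f ` S) C"
proof -
  interpret S: submonoid S A by fact
  show ?thesis
  proof
    show "f ` S \<subseteq> carrier C"
      unfolding image_plus_ideal_simps using graph_closed
      by (metis S.mem_carrier snd_conv imageI image_subsetI)
    show "x \<otimes>\<^bsub>C\<^esub> y \<in> f ` S" if "x \<in> f ` S" "y \<in> f ` S" for x y
      using that S.m_closed by (auto simp: image_plus_ideal_simps simp flip: f.hom_mult)
    show "\<one>\<^bsub>C\<^esub> \<in> f ` S"
      using imageI[OF S.one_closed, of f] by (simp add: image_plus_ideal_simps)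
  qed
qed

end

section \<open>The equivalences\<close>

theorem proposition3p4:
  fixes A :: "('a, 'm) ring_scheme" and B :: "('b, 'n) ring_scheme"
    and f :: "'a \<Rightarrow> 'b" and J :: "'b set" and S :: "'a set"
  assumes "cring A" and "cring B" and "f \<in> ring_hom A B"
    and "ideal J B" and "submonoid S A"
  shows "(u_noetherian_ring {(s, f s) | s. s \<in> S} (amalgamation A B f J) \<longleftrightarrow>
            u_noetherian_ring S A \<and>
            u_noetherian_module {(s, f s) | s. s \<in> S} (amalgamation A B f J)
              (amalgamation_ideal_module B J))
       \<and> (u_noetherian_ring {(s, f s) | s. s \<in> S} (amalgamation A B f J) \<longleftrightarrow>
            u_noetherian_ring S A \<and> u_noetherian_ring (f ` S) (image_plus_ideal A B f J))"
proof -
  interpret amalgamation_setting A B f J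
    using assms
    by (simp add: amalgamation_setting_def ring_hom_cring_def ring_hom_cring_axioms_def)
  interpret p: semilinear_map P "self_module P" A "self_module A" fst fst
    by (rule fst_semilinear)
  interpret q: semilinear_map P "self_module P" C "self_module C" snd snd
    by (rule snd_semilinear)
  interpret i: semilinear_map P "amalgamation_ideal_module B J" P "self_module P"
    "\<lambda>r. r" "\<lambda>j. (\<zero>\<^bsub>A\<^esub>, j)"
    by (rule ideal_into_amalgamation_semilinear)
  interpret k: semilinear_map P "amalgamation_ideal_module B J" C "self_module C" snd "\<lambda>j. j"
    by (rule ideal_into_image_plus_ideal_semilinear)
  let ?S' = "{(s, f s) | s. s \<in> S}"
  have S': "submonoid ?S' P"
    by (rule submonoid_amalgamation[OF assms(5)])
  \<comment> \<open>Equality serves both directions: images of scalars must land in the target set,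
    and scalars of the target set must lift.\<close>
  have fst_S': "fst ` ?S' = S" and snd_S': "snd ` ?S' = f ` S"
    by force+
  have A: "u_noetherian_ring S A" if "u_noetherian_ring ?S' P"
    using that p.u_noetherian_image[OF _ _ assms(5)] fst_surj fst_S'
    by (auto simp: u_noetherian_ring_def self_module_def module_via_simps)
  have C: "u_noetherian_ring (f ` S) C" if "u_noetherian_ring ?S' P"
    using that q.u_noetherian_image[OF _ _ submonoid_image_plus_ideal[OF assms(5)]] snd_S'
    by (auto simp: u_noetherian_ring_def self_module_def module_via_simps image_plus_ideal_simps)
  have P: "u_noetherian_ring ?S' P"
    if "u_noetherian_ring S A" "u_noetherian_module ?S' P (amalgamation_ideal_module B J)"
    unfolding u_noetherian_ring_def
  \<comment> \<open>The sequence from \<open>J\<close> through \<open>P\<close> to \<open>A\<close>,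
    with \<open>fst\<close> acting on scalars and on vectors.\<close>
  proof (rule p.u_noetherian_extension[OF S' fst_surj _ _ that(2)
        ideal_into_amalgamation_semilinear])
    show "u_noetherian_module S A (self_module A)"
      using that(1) by (simp add: u_noetherian_ring_def)
    show "x \<in> (\<lambda>j. (\<zero>\<^bsub>A\<^esub>, j)) ` carrier (amalgamation_ideal_module B J)"
      if "x \<in> carrier (self_module P)" "fst x = \<zero>\<^bsub>self_module A\<^esub>" for x
      using that zero_prod_iff by (cases x) (auto simp: carrier_simps)
  qed (simp add: fst_S')
  have J1: "u_noetherian_module ?S' P (amalgamation_ideal_module B J)" if "u_noetherian_ring ?S' P"
    by (rule i.u_noetherian_inj[OF S' _ that[unfolded u_noetherian_ring_def]])
      (auto simp: inj_on_def)
  have J2: "u_noetherian_module ?S' P (amalgamation_ideal_module B J)"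
    if "u_noetherian_ring (f ` S) C"
    by (rule k.u_noetherian_inj[OF S' _ that[unfolded u_noetherian_ring_def]])
      (simp_all add: image_plus_ideal_simps snd_S')
  \<comment> \<open>The condition on \<open>P\<close> yields the other two by \<open>A\<close>,
    \<open>J1\<close> and \<open>C\<close>. The condition on \<open>C\<close> is turned into the one
    on \<open>J\<close> by \<open>J2\<close>, and \<open>P\<close> leads back.\<close>
  from A C P J1 J2 show ?thesis
    by blast
qed

end
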